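(* For $n\ge 0$ let $a_n$ be the number of signed permutations $\alpha=\alpha_1\alpha_2\cdots\alpha_n\in B_n$ that contain no factor of the form $i(i+1)$ and no factor of the form $(\overline{i+1})\,\overline{i}$. Then the exponential generating function of $(a_n)_{n\ge 0}$ is $$A(t)=\sum_{n\geq 0}\frac{a_{n}t^n}{n!}=1+2\int_{0}^{t}\frac{e^{-z}}{(1-2z)^2}\,dz .$$ The initial values of $a_n$, starting with $n=0$, are $$1,2,6,34,262,2562,30278,419234,6651846,118950658,2366492038,\ldots.$$
   Context: $B_n$ is the hyperoctahedral group, whose elements are regarded as signed permutations: words $\alpha_1\alpha_2\cdots\alpha_n$ in which each of the letters $1,2,\ldots,n$ appears exactly once, either unbarred (as $i$) or barred (as $\overline{i}$). Thus $|B_n|=2^n n!$; $B_0$ consists of the empty word. A factor is a block of consecutive letters. A factor $i(i+1)$ means two consecutive positions $\alpha_p\alpha_{p+1}$ with $\alpha_p=i$, $\alpha_{p+1}=i+1$, both unbarred, for some $1\le i\le n-1$; a factor $(\overline{i+1})\,\overline{i}$ means two consecutive positions with $\alpha_p=\overline{i+1}$, $\alpha_{p+1}=\overline{i}$, both barred, for some $1\le i\le n-1$. *)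

theory Defs
  imports "HOL-Analysis.Analysis" "HOL-Library.Sublist"
    "HOL-Computational_Algebra.Formal_Power_Series"
begin

text \<open>The unbarred letter \<open>i\<close> is encoded as the positive integer \<open>i\<close>, the barred letter
  as \<open>- i\<close>.\<close>

definition signed_perms :: "nat \<Rightarrow> int list set" where
  "signed_perms n = {w. distinct (map abs w) \<and> set (map abs w) = {1..int n}}"

definition succession_free :: "nat \<Rightarrow> int list \<Rightarrow> bool" where
  "succession_free n w \<longleftrightarrow>
     (\<forall>i\<in>{1..int n - 1}. \<not> sublist [i, i + 1] w \<and> \<not> sublist [- (i + 1), - i] w)"

definition succession_free_count :: "nat \<Rightarrow> nat" where
  "succession_free_count n = card {w \<in> signed_perms n. succession_free n w}"

end

(* Barred and unbarred successions are both adjacent pairs (x, x + 1) of integers. Inserting the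
   letter n + 1 or -(n + 1) in all 2(n + 1) ways into a signed permutation with s successions yields
   one word with s + 1 successions, 2s words with s - 1, and 2n + 1 - 2s words with s. Hence the
   binomial moments of the number of successions are C(n, j) 2^(n+1-j) (n+1-j)! on B_(n+1), and
   inclusion-exclusion gives a_(n+1) as their alternating sum; so a_(n+1) / n! is a convolution of
   the coefficients of exp(-z) and 2 / (1 - 2z)^2. *)

theory Submission
  imports Defs
begin

section \<open>Successions and the insertion of one letter\<close>

fun num_succ :: "int list \<Rightarrow> nat" where
  "num_succ (x # y # zs) = of_bool (y = x + 1) + num_succ (y # zs)"
| "num_succ _ = 0"

definition insert_at :: "nat \<Rightarrow> 'a \<Rightarrow> 'a list \<Rightarrow> 'a list" where
  "insert_at p a w = take p w @ a # drop p w"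

lemma insert_at_0 [simp]: "insert_at 0 a w = a # w"
  by (simp add: insert_at_def)

lemma insert_at_Suc_Cons [simp]: "insert_at (Suc p) a (x # w) = x # insert_at p a w"
  by (simp add: insert_at_def)

lemma num_succ_Cons_le: "num_succ (x # w) \<le> length w"
  by (induction w arbitrary: x) (auto intro: le_SucI)

lemma num_succ_zero_iff: "num_succ w = 0 \<longleftrightarrow> (\<forall>x. \<not> sublist [x, x + 1] w)"
  by (induction w rule: num_succ.induct) (auto simp: sublist_Cons_right prefix_Cons)

text \<open>The \<open>c\<close> gaps right after \<open>a - 1\<close> or right before
  \<open>a + 1\<close> gain a succession, and \<open>c \<le> 1\<close> excludes a gap that gains
  two. The gap inside a succession loses it and cannot gain one, because \<open>a\<close> does not
  occur in the word. The head is not searched for \<open>a + 1\<close> since nothing is inserted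
  before it.\<close>

lemma sum_insert_after_head:
  fixes F :: "nat \<Rightarrow> int"
  assumes "a \<notin> set (x # w)" "distinct (x # w)"
    and "count_list (x # w) (a - 1) + count_list w (a + 1) = c" "c \<le> 1"
  shows "(\<Sum>p\<le>length w. F (num_succ (x # insert_at p a w))) =
    int c * F (num_succ (x # w) + 1) + int (num_succ (x # w)) * F (num_succ (x # w) - 1)
    + (int (length w) + 1 - int c - int (num_succ (x # w))) * F (num_succ (x # w))"
  using assms
proof (induction w arbitrary: x F c)
  case Nil
  then show ?case by auto
next
  case (Cons y w)
  let ?s = "num_succ (y # w)"
  define c' where "c' = count_list (y # w) (a - 1) + count_list w (a + 1)"
  have c: "c = of_bool (x = a - 1) + of_bool (y = a + 1) + c'"
    using Cons.prems by (auto simp: c'_def)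
  have IH: "(\<Sum>p\<le>length w. G (num_succ (y # insert_at p a w))) =
    int c' * G (?s + 1) + int ?s * G (?s - 1)
    + (int (length w) + 1 - int c' - int ?s) * G ?s" for G
    using Cons.IH[of y c' G] Cons.prems c by (auto simp: c'_def)
  \<comment> \<open>The gap between \<open>x\<close> and \<open>y\<close> is split off. In all later
    gaps the pair \<open>x\<close>, \<open>y\<close> survives and only shifts the argument of
    \<open>F\<close>, which is why \<open>F\<close> is arbitrary in the induction.\<close>
  have "(\<Sum>p\<le>length (y # w). F (num_succ (x # insert_at p a (y # w)))) =
    F (of_bool (x = a - 1) + of_bool (y = a + 1) + ?s) +
    (\<Sum>p\<le>length w. F (of_bool (y = x + 1) + num_succ (y # insert_at p a w)))"
    by (auto simp: sum.atMost_Suc_shift simp del: sum.atMost_Suc)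
  also have "\<dots> = F (of_bool (x = a - 1) + of_bool (y = a + 1) + ?s) +
    (int c' * F (of_bool (y = x + 1) + (?s + 1)) + int ?s * F (of_bool (y = x + 1) + (?s - 1))
    + (int (length w) + 1 - int c' - int ?s) * F (of_bool (y = x + 1) + ?s))"
    by (subst IH[of "\<lambda>k. F (of_bool (y = x + 1) + k)"]) (rule refl)
  \<comment> \<open>For \<open>?s = 0\<close> the truncated \<open>?s - 1\<close> has coefficient 0;
    otherwise it is a true predecessor.\<close>
  finally show ?case
    using Cons.prems c by (cases "?s = 0") (auto simp: algebra_simps)
qed

text \<open>The gap before the head is added: no pair is broken there, and a succession arises
  exactly if the head is \<open>a + 1\<close>.\<close>

lemma sum_insert_at:
  fixes F :: "nat \<Rightarrow> int"
  assumes "w \<noteq> []" "a \<notin> set w" "distinct w"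
    and "count_list w (a - 1) + count_list w (a + 1) = c" "c \<le> 1"
  shows "(\<Sum>p\<le>length w. F (num_succ (insert_at p a w))) =
    int c * F (num_succ w + 1) + int (num_succ w) * F (num_succ w - 1)
    + (int (length w) + 1 - int c - int (num_succ w)) * F (num_succ w)"
proof -
  obtain x v where w: "w = x # v" using assms(1) by (cases w) auto
  define c' where "c' = count_list (x # v) (a - 1) + count_list v (a + 1)"
  have c: "c = c' + of_bool (x = a + 1)" using assms by (auto simp: c'_def w)
  have *: "(\<Sum>p\<le>length v. F (num_succ (x # insert_at p a v))) =
    int c' * F (num_succ (x # v) + 1) + int (num_succ (x # v)) * F (num_succ (x # v) - 1)
    + (int (length v) + 1 - int c' - int (num_succ (x # v))) * F (num_succ (x # v))"
    by (rule sum_insert_after_head) (use assms c in \<open>auto simp: w c'_def\<close>)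
  have "(\<Sum>p\<le>length w. F (num_succ (insert_at p a w))) =
     F (of_bool (x = a + 1) + num_succ w) + (\<Sum>p\<le>length v. F (num_succ (x # insert_at p a v)))"
    by (simp add: w sum.atMost_Suc_shift del: sum.atMost_Suc)
  then show ?thesis using * c assms(5) by (auto simp: w algebra_simps)
qed

section \<open>Signed permutations built by inserting the largest letter\<close>

lemma signed_perms_0: "signed_perms 0 = {[]}"
  by (auto simp: signed_perms_def)

lemma signed_permsD:
  assumes "w \<in> signed_perms n"
  shows "distinct w" "length w = n" "0 \<notin> set w" "\<And>x. x \<in> set w \<Longrightarrow> \<bar>x\<bar> \<le> int n"
    and "n > 0 \<Longrightarrow> count_list w (int n) + count_list w (- int n) = 1"
proof -
  have d: "distinct (map abs w)" and s: "set (map abs w) = {1..int n}"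
    using assms by (auto simp: signed_perms_def)
  show "distinct w" using d by (simp add: distinct_map)
  show "length w = n" using distinct_card[OF d] s by simp
  show "0 \<notin> set w" using s by force
  show "\<bar>x\<bar> \<le> int n" if "x \<in> set w" for x
  proof -
    have "\<bar>x\<bar> \<in> {1..int n}" using that by (auto simp flip: s)
    then show ?thesis by simp
  qed
  assume n: "n > 0"
  have "count_list w (int n) + count_list w (- int n) = count_list (map abs w) (int n)"
    using n by (induction w) auto
  also have "\<dots> = 1"
  proof -
    have "count_list xs x = 1" if "distinct xs" "x \<in> set xs" for x :: int and xs
      using that by (induction xs) (auto simp: count_list_0_iff)
    then show ?thesis using d s n by auto
  qed
  finally show "count_list w (int n) + count_list w (- int n) = 1" .
qed

text \<open>The letter of absolute value \<open>n + 1\<close> is unique in the longer word: deleting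
  it recovers \<open>w\<close>, and the length of the prefix before it recovers the
  position.\<close>

lemma signed_perms_Suc:
  "bij_betw (\<lambda>(w, p, a). insert_at p a w)
     (signed_perms n \<times> {..n} \<times> {int (Suc n), - int (Suc n)}) (signed_perms (Suc n))"
  (is "bij_betw ?f ?A _")
proof (rule bij_betwI')
  let ?P = "\<lambda>x. \<bar>x\<bar> \<noteq> int (Suc n)"
  have small: "?P x" if "w \<in> signed_perms n" "x \<in> set w" for w x
    using signed_permsD(4)[OF that] by simp
  have inv: "filter ?P (insert_at p a w) = w \<and> takeWhile ?P (insert_at p a w) = take p w"
    if "w \<in> signed_perms n" "\<bar>a\<bar> = int (Suc n)" for w p a
  proof -
    have "filter ?P (take p w) = take p w" "filter ?P (drop p w) = drop p w"
      using small[OF that(1)] by (auto simp: filter_id_conv dest: in_set_takeD in_set_dropD)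
    moreover have "takeWhile ?P (take p w @ a # drop p w) = take p w"
      using small[OF that(1)] that(2) by (subst takeWhile_append2) (auto dest: in_set_takeD)
    ultimately show ?thesis using that(2) by (simp add: insert_at_def)
  qed
  show "?f x = ?f y \<longleftrightarrow> x = y" if xy: "x \<in> ?A" "y \<in> ?A" for x y
  proof
    assume eq: "?f x = ?f y"
    obtain w p a v q b where x: "x = (w, p, a)" and y: "y = (v, q, b)"
      by (cases x, cases y) auto
    have "w = v" "take p w = take q v"
      using inv[of w a p] inv[of v b q] eq xy x y by auto
    moreover have "p \<le> length w" "q \<le> length v"
      using xy x y by (auto dest: signed_permsD(2))
    ultimately have "p = q" by (metis length_take min.absorb2)
    with \<open>w = v\<close> eq show "x = y" by (simp add: x y insert_at_def)
  qed simp
  show "?f x \<in> signed_perms (Suc n)" if "x \<in> ?A" for x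
  proof -
    obtain w p a where x: "x = (w, p, a)" by (cases x)
    have w: "w \<in> signed_perms n" and a: "\<bar>a\<bar> = int (Suc n)" using that x by auto
    have "mset (insert_at p a w) = mset (a # w)"
      by (simp add: insert_at_def flip: union_code mset_append)
    then have m: "mset (map abs (insert_at p a w)) = mset (map abs (a # w))"
      by (simp only: mset_map)
    have "distinct (map abs (a # w))" "set (map abs (a # w)) = {1..int (Suc n)}"
      using w a small[OF w] by (auto simp: signed_perms_def)
    then show ?thesis
      using m mset_eq_imp_distinct_iff[OF m] mset_eq_setD[OF m] by (simp add: x signed_perms_def)
  qed
  show "\<exists>x\<in>?A. u = ?f x" if u: "u \<in> signed_perms (Suc n)" for u
  proof -
    have d: "distinct (map abs u)" and s: "set (map abs u) = {1..int (Suc n)}"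
      using u by (auto simp: signed_perms_def)
    have "int (Suc n) \<in> set (map abs u)" using s by simp
    then obtain a where "a \<in> set u" and a: "\<bar>a\<bar> = int (Suc n)" by auto
    then obtain xs ys where xy: "u = xs @ a # ys" by (meson split_list)
    have "set (map abs (xs @ ys)) = set (map abs u) - {int (Suc n)}"
      using d a by (auto simp: xy)
    also have "\<dots> = {1..int n}" unfolding s by auto
    finally have "xs @ ys \<in> signed_perms n" using d by (simp add: xy signed_perms_def image_Un)
    moreover from this have "length xs \<le> n" by (auto dest: signed_permsD(2))
    ultimately show ?thesis using a
      by (intro bexI[of _ "(xs @ ys, length xs, a)"]) (auto simp: insert_at_def xy)
  qed
qed

lemma finite_signed_perms: "finite (signed_perms n)"
proof (induction n)
  case (Suc n)
  then show ?case using bij_betw_finite[OF signed_perms_Suc[of n]] by simp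
qed (simp add: signed_perms_0)

text \<open>Exactly one of \<open>n\<close> and \<open>- n\<close> occurs in \<open>w\<close>, and
  it offers the only gap where \<open>n + 1\<close> or \<open>- (n + 1)\<close> forms a succession;
  every old succession can be broken by either sign. For \<open>n = 0\<close> there is no such
  neighbour and the rule fails.\<close>

lemma sum_signed_perms_Suc:
  fixes F :: "nat \<Rightarrow> int"
  assumes "n > 0"
  shows "(\<Sum>u\<in>signed_perms (Suc n). F (num_succ u)) =
    (\<Sum>w\<in>signed_perms n. F (num_succ w + 1) + 2 * int (num_succ w) * F (num_succ w - 1)
      + (2 * int n + 1 - 2 * int (num_succ w)) * F (num_succ w))"
proof -
  have "(\<Sum>u\<in>signed_perms (Suc n). F (num_succ u)) =
    (\<Sum>(w, p, a)\<in>signed_perms n \<times> {..n} \<times> {int (Suc n), - int (Suc n)}. F (num_succ (insert_at p a w)))"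
    by (subst sum.reindex_bij_betw[OF signed_perms_Suc, symmetric]) (simp add: case_prod_unfold)
  also have "\<dots> = (\<Sum>w\<in>signed_perms n. (\<Sum>p\<le>n. F (num_succ (insert_at p (int (Suc n)) w)))
      + (\<Sum>p\<le>n. F (num_succ (insert_at p (- int (Suc n)) w))))"
    by (simp add: sum.cartesian_product[symmetric] sum.distrib)
  also have "\<dots> = (\<Sum>w\<in>signed_perms n. F (num_succ w + 1)
      + 2 * int (num_succ w) * F (num_succ w - 1)
      + (2 * int n + 1 - 2 * int (num_succ w)) * F (num_succ w))"
  proof (rule sum.cong[OF refl])
    fix w assume "w \<in> signed_perms n"
    note w = signed_permsD[OF this]
    have far: "x \<notin> set w" if "\<bar>x\<bar> > int n" for x
      using w(4)[of x] that by auto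
    have ne: "w \<noteq> []" using w(2) assms by auto
    have one: "count_list w (int n) + count_list w (- int n) = 1" using w(5) assms by simp
    \<comment> \<open>Of the neighbours \<open>n\<close> and \<open>n + 2\<close> of the inserted
      letter only \<open>n\<close> can occur in \<open>w\<close>.\<close>
    have 1: "(\<Sum>p\<le>length w. F (num_succ (insert_at p (int (Suc n)) w))) =
      int (count_list w (int n)) * F (num_succ w + 1) + int (num_succ w) * F (num_succ w - 1)
      + (int (length w) + 1 - int (count_list w (int n)) - int (num_succ w)) * F (num_succ w)"
      using ne w(1) one far[of "int n + 2"] far[of "int n + 1"]
      by (intro sum_insert_at) (auto simp: algebra_simps)
    \<comment> \<open>Mirrored: now \<open>- n\<close> is \<open>a + 1\<close>, and
      \<open>a - 1\<close> is too large in absolute value to occur.\<close>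
    have 2: "(\<Sum>p\<le>length w. F (num_succ (insert_at p (- int (Suc n)) w))) =
      int (count_list w (- int n)) * F (num_succ w + 1) + int (num_succ w) * F (num_succ w - 1)
      + (int (length w) + 1 - int (count_list w (- int n)) - int (num_succ w)) * F (num_succ w)"
      using ne w(1) one far[of "- int n - 2"] far[of "- 1 - int n"]
      by (intro sum_insert_at) (auto simp: algebra_simps)
    have 3: "int (count_list w (- int n)) = 1 - int (count_list w (int n))"
      using one by linarith
    show "(\<Sum>p\<le>n. F (num_succ (insert_at p (int (Suc n)) w)))
      + (\<Sum>p\<le>n. F (num_succ (insert_at p (- int (Suc n)) w))) = F (num_succ w + 1)
      + 2 * int (num_succ w) * F (num_succ w - 1)
      + (2 * int n + 1 - 2 * int (num_succ w)) * F (num_succ w)"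
      using 1 2 unfolding w(2) 3 by (simp add: algebra_simps)
  qed
  finally show ?thesis .
qed

section \<open>Binomial moments of the number of successions\<close>

lemma signed_perms_1: "signed_perms (Suc 0) = {[1], [- 1]}"
  using bij_betw_imp_surj_on[OF signed_perms_Suc[of 0]]
  by (auto simp: signed_perms_0 insert_at_def)

text \<open>The binomial transform turns the insertion rule into a two-term recurrence.\<close>

lemma choose_insertion_rule:
  "int (Suc s choose Suc j) + 2 * int s * int (s - 1 choose Suc j)
     + (2 * int n + 1 - 2 * int s) * int (s choose Suc j) =
   int (s choose j) + 2 * (int n - int j) * int (s choose Suc j)"
proof (cases s)
  case (Suc r)
  \<comment> \<open>The absorption identity for \<open>s = r + 1\<close>, kept additive so that no
    truncated subtraction enters before the passage to integers.\<close>
  have "Suc r * (r choose Suc j) + Suc j * (Suc r choose Suc j) = Suc r * (Suc r choose Suc j)"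
    using Suc_times_binomial[of j r] by (simp add: algebra_simps)
  then have "int s * int (r choose Suc j) = (int s - int j - 1) * int (s choose Suc j)"
    unfolding Suc by (simp add: algebra_simps flip: of_nat_mult of_nat_add)
  then show ?thesis using Suc by (simp add: algebra_simps)
qed simp

text \<open>Both sides count words with \<open>j\<close> marked successions: on the right,
  \<open>j\<close> of the \<open>n\<close> pairs of consecutive absolute values are glued and the
  \<open>n + 1 - j\<close> blocks are arranged with signs. The proof does not glue but inducts with
  the insertion rule.\<close>

lemma sum_choose_num_succ:
  "(\<Sum>w\<in>signed_perms (Suc n). int (num_succ w choose j)) =
     int (n choose j) * 2 ^ (Suc n - j) * fact (Suc n - j)"
proof (induction n arbitrary: j)
  case 0
  then show ?case by (cases j) (simp_all add: signed_perms_1)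
next
  case (Suc n)
  show ?case
  proof (cases j)
    case 0
    then show ?thesis
      using sum_signed_perms_Suc[of "Suc n" "\<lambda>s. int (s choose 0)"] Suc.IH[of 0]
      by (simp add: algebra_simps sum.distrib flip: sum_distrib_left)
  next
    case (Suc i)
    have "(\<Sum>w\<in>signed_perms (Suc (Suc n)). int (num_succ w choose j)) =
      (\<Sum>w\<in>signed_perms (Suc n). int (num_succ w choose i) +
         2 * (int (Suc n) - int i) * int (num_succ w choose Suc i))"
      unfolding Suc sum_signed_perms_Suc[of "Suc n" "\<lambda>s. int (s choose Suc i)", OF zero_less_Suc]
        Suc_eq_plus1[symmetric] choose_insertion_rule
      by (rule refl)
    also have "\<dots> = int (n choose i) * 2 ^ (Suc n - i) * fact (Suc n - i) +
      2 * (int (Suc n) - int i) * (int (n choose Suc i) * 2 ^ (n - i) * fact (n - i))"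
      using Suc.IH[of i] Suc.IH[of "Suc i"] by (simp add: sum.distrib flip: sum_distrib_left)
    \<comment> \<open>The factor \<open>n + 1 - i\<close> completes the factorial of the second
      term, and Pascal's rule adds the two terms; for \<open>i > n\<close> all the binomials
      vanish.\<close>
    also have "\<dots> = int (Suc n choose j) * 2 ^ (Suc (Suc n) - j) * fact (Suc (Suc n) - j)"
    proof (cases "i \<le> n")
      case True
      then show ?thesis by (simp add: Suc Suc_diff_le algebra_simps of_nat_diff)
    qed (simp add: Suc)
    finally show ?thesis .
  qed
qed

section \<open>Inclusion-exclusion for succession-free words\<close>

text \<open>As 0 is not a letter, \<open>x\<close> and \<open>x + 1\<close> in a word have the same
  sign: positive pairs are the factors \<open>[i, i + 1]\<close>, negative ones the factors
  \<open>[- (i + 1), - i]\<close>.\<close>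

lemma succession_free_iff:
  assumes "w \<in> signed_perms n"
  shows "succession_free n w \<longleftrightarrow> num_succ w = 0"
proof
  assume sf: "succession_free n w"
  have "\<not> sublist [x, x + 1] w" for x
  proof
    assume sub: "sublist [x, x + 1] w"
    then have "x \<in> set w" "x + 1 \<in> set w" using set_mono_sublist by fastforce+
    then have b: "x \<noteq> 0" "x + 1 \<noteq> 0" "\<bar>x\<bar> \<le> int n" "\<bar>x + 1\<bar> \<le> int n"
      using signed_permsD(3,4)[OF assms] by (metis | auto)+
    show False
    proof (cases "x > 0")
      case True
      then have "x \<in> {1..int n - 1}" using b by auto
      then show False using sf sub by (auto simp: succession_free_def)
    next
      case False
      \<comment> \<open>With \<open>i = - x - 1\<close> the barred factor
        \<open>[- (i + 1), - i]\<close> is \<open>[x, x + 1]\<close>.\<close>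
      then have "- x - 1 \<in> {1..int n - 1}" using b by auto
      then have "\<not> sublist [- ((- x - 1) + 1), - (- x - 1)] w"
        using sf unfolding succession_free_def by blast
      then show False using sub by (simp add: add.commute)
    qed
  qed
  then show "num_succ w = 0" by (simp add: num_succ_zero_iff)
next
  assume "num_succ w = 0"
  then have *: "\<not> sublist [x, x + 1] w" for x by (simp add: num_succ_zero_iff)
  show "succession_free n w"
    unfolding succession_free_def
  proof
    fix i
    show "\<not> sublist [i, i + 1] w \<and> \<not> sublist [- (i + 1), - i] w"
      using *[of i] *[of "- (i + 1)"] by simp
  qed
qed

lemma succession_free_count_0: "succession_free_count 0 = 1"
proof -
  have "{w \<in> signed_perms 0. succession_free 0 w} = {[]}"
    by (auto simp: signed_perms_0 succession_free_def)
  then show ?thesis by (simp add: succession_free_count_def)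
qed

text \<open>The alternating sum of \<open>s choose j\<close> over \<open>j\<close> is the indicator
  of \<open>s = 0\<close>. A word of \<open>n + 1\<close> letters has at most \<open>n\<close>
  successions, so \<open>j \<le> n\<close> suffices for all words at once and the two sums can be
  exchanged.\<close>

lemma succession_free_count_Suc:
  "int (succession_free_count (Suc n)) =
     (\<Sum>j\<le>n. (- 1) ^ j * int (n choose j) * 2 ^ (Suc n - j) * fact (Suc n - j))"
proof -
  have "int (succession_free_count (Suc n)) =
    (\<Sum>w\<in>signed_perms (Suc n). of_bool (num_succ w = 0))"
  proof -
    have "{w \<in> signed_perms (Suc n). succession_free (Suc n) w} =
        signed_perms (Suc n) \<inter> {w. num_succ w = 0}"
      using succession_free_iff by blast
    then show ?thesis
      by (simp add: succession_free_count_def sum_of_bool_eq finite_signed_perms)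
  qed
  also have "\<dots> = (\<Sum>w\<in>signed_perms (Suc n). \<Sum>j\<le>n. (- 1) ^ j * int (num_succ w choose j))"
  proof (rule sum.cong[OF refl])
    fix w assume w: "w \<in> signed_perms (Suc n)"
    then have "length w = Suc n" by (rule signed_permsD)
    then have le: "num_succ w \<le> n"
      using num_succ_Cons_le by (cases w) auto
    have "(\<Sum>j\<le>n. (- 1) ^ j * int (num_succ w choose j)) =
      (\<Sum>j\<le>num_succ w. (- 1) ^ j * int (num_succ w choose j))"
      using le by (intro sum.mono_neutral_right) (auto simp: not_le)
    also have "\<dots> = of_bool (num_succ w = 0)"
      using choose_alternating_sum[of "num_succ w", where 'a = int] by (cases "num_succ w = 0") auto
    finally show "of_bool (num_succ w = 0) = (\<Sum>j\<le>n. (- 1) ^ j * int (num_succ w choose j))"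
      by simp
  qed
  also have "\<dots> = (\<Sum>j\<le>n. (- 1) ^ j * (\<Sum>w\<in>signed_perms (Suc n). int (num_succ w choose j)))"
    by (subst sum.swap) (simp add: sum_distrib_left)
  finally show ?thesis by (simp add: sum_choose_num_succ mult.assoc)
qed

section \<open>The generating function as a formal power series\<close>

text \<open>Cauchy product of the coefficients of \<open>exp (- z)\<close> and
  \<open>1 / (1 - 2 * z)^2\<close>: half of the derivative of the generating function
  sought.\<close>

definition egf_deriv_coeff :: "nat \<Rightarrow> real" where
  "egf_deriv_coeff n = (\<Sum>j\<le>n. (- 1) ^ j / fact j * (real (Suc (n - j)) * 2 ^ (n - j)))"

text \<open>Termwise, \<open>(n choose j) * (n + 1 - j)! / n!\<close> is
  \<open>(n + 1 - j) / j!\<close>, and one factor 2 is taken out of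
  \<open>2 ^ (n + 1 - j)\<close>.\<close>

lemma succession_free_count_egf_deriv:
  "real (succession_free_count (Suc n)) / fact n = 2 * egf_deriv_coeff n"
proof -
  have "real (succession_free_count (Suc n)) = of_int (int (succession_free_count (Suc n)))"
    by simp
  also have "\<dots> / fact n = 2 * egf_deriv_coeff n"
    unfolding egf_deriv_coeff_def succession_free_count_Suc of_int_sum sum_divide_distrib sum_distrib_left
  proof (rule sum.cong[OF refl])
    fix j assume "j \<in> {..n}"
    then show "of_int ((- 1) ^ j * int (n choose j) * 2 ^ (Suc n - j) * fact (Suc n - j)) / fact n =
      2 * ((- 1) ^ j / fact j * (real (Suc (n - j)) * 2 ^ (n - j)))"
      by (simp add: Suc_diff_le binomial_fact field_simps)
  qed
  finally show ?thesis .
qed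

text \<open>One multiplication by \<open>1 - 2 * fps_X\<close> leaves the geometric series, a second
  one leaves 1.\<close>

lemma inverse_one_minus_2X_squared:
  "inverse ((1 - 2 * fps_X)\<^sup>2 :: real fps) = Abs_fps (\<lambda>n. real (Suc n) * 2 ^ n)"
proof -
  have "Abs_fps (\<lambda>n. real (Suc n) * 2 ^ n) * (1 - 2 * fps_X) = Abs_fps (\<lambda>n. 2 ^ n)"
    by (rule fps_ext, rename_tac n, case_tac n)
       (simp_all add: algebra_simps numeral_fps_const)
  moreover have "Abs_fps (\<lambda>n. 2 ^ n :: real) * (1 - 2 * fps_X) = 1"
    by (rule fps_ext, rename_tac n, case_tac n)
       (simp_all add: algebra_simps numeral_fps_const)
  ultimately have "(1 - 2 * fps_X)\<^sup>2 * Abs_fps (\<lambda>n. real (Suc n) * 2 ^ n) = 1"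
    by (simp add: power2_eq_square mult_ac)
  then show ?thesis by (rule fps_inverse_unique)
qed

lemma fps_nth_egf_deriv:
  "fps_nth (fps_exp (- 1) / (1 - 2 * fps_X)\<^sup>2) n = egf_deriv_coeff n"
proof -
  have "fps_exp (- 1) / (1 - 2 * fps_X)\<^sup>2 =
      fps_exp (- 1) * Abs_fps (\<lambda>n. real (Suc n) * 2 ^ n)"
    by (subst fps_divide_unit) (simp_all add: inverse_one_minus_2X_squared)
  then show ?thesis
    by (simp add: fps_mult_nth egf_deriv_coeff_def atMost_atLeast0)
qed

text \<open>Integration divides coefficient \<open>m\<close> by \<open>m + 1\<close> and moves it to
  \<open>m + 1\<close>, which turns the denominator \<open>fact m\<close> into
  \<open>fact (Suc m)\<close>; the constant 1 is the count for the empty word.\<close>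

lemma succession_free_count_fps:
  "Abs_fps (\<lambda>n. real (succession_free_count n) / fact n) =
     1 + 2 * fps_integral0 (fps_exp (- 1) / (1 - 2 * fps_X)\<^sup>2)"
proof (rule fps_ext)
  fix n
  show "fps_nth (Abs_fps (\<lambda>n. real (succession_free_count n) / fact n)) n =
    fps_nth (1 + 2 * fps_integral0 (fps_exp (- 1) / (1 - 2 * fps_X)\<^sup>2)) n"
  proof (cases n)
    case (Suc m)
    have "real (succession_free_count n) / fact n =
        real (succession_free_count (Suc m)) / fact m / real (Suc m)"
      by (simp add: Suc del: of_nat_Suc)
    also have "\<dots> = 2 * (egf_deriv_coeff m / real (Suc m))"
      by (simp only: succession_free_count_egf_deriv times_divide_eq_right)
    finally have "real (succession_free_count n) / fact n = 2 * (egf_deriv_coeff m / real (Suc m))" .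
    moreover have "fps_nth (2 * f) n = 2 * fps_nth f n" for f :: "real fps"
      by (simp add: numeral_fps_const)
    ultimately show ?thesis
      by (simp add: Suc fps_integral_def fps_nth_egf_deriv inverse_eq_divide del: of_nat_Suc)
  qed (simp add: succession_free_count_0 numeral_fps_const fps_integral_def)
qed

section \<open>Convergence and the integral formula\<close>

text \<open>Cauchy product of two absolutely convergent series: the exponential series at
  \<open>- z\<close> and the differentiated geometric series at \<open>2 * z\<close>. The latter
  imposes the bound 1/2.\<close>

lemma egf_deriv_sums:
  fixes z :: real
  assumes "\<bar>z\<bar> < 1 / 2"
  shows "(\<lambda>n. egf_deriv_coeff n * z ^ n) sums (exp (- z) / (1 - 2 * z)\<^sup>2)"
proof -
  have e: "(\<lambda>n. (- z) ^ n /\<^sub>R fact n) sums exp (- z)" by (rule exp_converges)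
  have e': "summable (\<lambda>n. norm ((- z) ^ n /\<^sub>R fact n))" by (rule summable_norm_exp)
  have nz: "norm (2 * z) < 1" using assms by simp
  have g: "(\<lambda>n. of_nat (Suc n) * (2 * z) ^ n) sums (1 / (1 - 2 * z)\<^sup>2)"
    by (rule geometric_deriv_sums[OF nz])
  have g': "summable (\<lambda>n. norm (of_nat (Suc n) * (2 * z) ^ n))"
  proof -
    have "summable (\<lambda>n. of_nat (Suc n) * norm (2 * z) ^ n)"
      using nz by (intro sums_summable[OF geometric_deriv_sums]) simp
    then show ?thesis by (simp only: norm_mult norm_power norm_of_nat)
  qed
  have "(\<lambda>n. \<Sum>j\<le>n. ((- z) ^ j /\<^sub>R fact j) * (of_nat (Suc (n - j)) * (2 * z) ^ (n - j))) sums
      (exp (- z) * (1 / (1 - 2 * z)\<^sup>2))"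
    using Cauchy_product_sums[OF e' g'] e g by (simp add: sums_iff)
  also have "(\<lambda>n. \<Sum>j\<le>n. ((- z) ^ j /\<^sub>R fact j) * (of_nat (Suc (n - j)) * (2 * z) ^ (n - j))) =
      (\<lambda>n. egf_deriv_coeff n * z ^ n)"
  proof
    fix n
    have "((- z) ^ j /\<^sub>R fact j) * (of_nat (Suc (n - j)) * (2 * z) ^ (n - j)) =
      ((- 1) ^ j / fact j * (real (Suc (n - j)) * 2 ^ (n - j))) * z ^ n" if "j \<le> n" for j
    proof -
      have "z ^ n = z ^ j * z ^ (n - j)" using that by (simp flip: power_add)
      moreover have "(- z) ^ j = (- 1) ^ j * z ^ j" by (rule power_minus)
      ultimately show ?thesis by (simp add: power_mult_distrib divide_inverse mult_ac)
    qed
    then show "(\<Sum>j\<le>n. ((- z) ^ j /\<^sub>R fact j) * (of_nat (Suc (n - j)) * (2 * z) ^ (n - j))) =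
      egf_deriv_coeff n * z ^ n"
      by (simp add: egf_deriv_coeff_def sum_distrib_right)
  qed
  finally show ?thesis by simp
qed

lemma diffs_succession_free_count:
  "diffs (\<lambda>n. real (succession_free_count n) / fact n) n = 2 * egf_deriv_coeff n"
proof -
  have "diffs (\<lambda>n. real (succession_free_count n) / fact n) n =
      real (succession_free_count (Suc n)) / fact n"
    by (simp add: diffs_def del: of_nat_Suc)
  then show ?thesis by (simp only: succession_free_count_egf_deriv)
qed

text \<open>Apart from the constant term, the series is dominated by the series of its derivative,
  since \<open>fact n \<le> fact (Suc n)\<close>.\<close>

lemma summable_succession_free_count:
  fixes t :: real
  assumes "\<bar>t\<bar> < 1 / 2"
  shows "summable (\<lambda>n. real (succession_free_count n) / fact n * t ^ n)"
proof -
  \<comment> \<open>The midpoint of \<open>\<bar>t\<bar>\<close> and 1/2: convergence at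
    \<open>r\<close> gives absolute convergence at the smaller \<open>t\<close>.\<close>
  define r where "r = (\<bar>t\<bar> + 1 / 2) / 2"
  have r: "\<bar>r\<bar> < 1 / 2" "\<bar>t\<bar> < \<bar>r\<bar>" using assms by (auto simp: r_def)
  have "summable (\<lambda>n. norm (2 * egf_deriv_coeff n * t ^ n))"
    using powser_insidea[of "\<lambda>n. 2 * egf_deriv_coeff n" r t] r
      sums_mult[OF egf_deriv_sums[OF r(1)], of 2] by (auto simp: sums_iff mult.assoc)
  then have "summable (\<lambda>n. \<bar>t\<bar> * norm (2 * egf_deriv_coeff n * t ^ n))"
    by (rule summable_mult)
  then have "summable (\<lambda>n. real (succession_free_count (Suc n)) / fact (Suc n) * t ^ Suc n)"
  proof (rule summable_comparison_test'[where N = 0])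
    fix n
    have "2 * egf_deriv_coeff n = real (succession_free_count (Suc n)) / fact n"
      by (simp only: succession_free_count_egf_deriv)
    moreover have "(fact n :: real) \<le> fact (Suc n)" by (rule fact_mono) simp
    then have "real (succession_free_count (Suc n)) / fact (Suc n)
        \<le> real (succession_free_count (Suc n)) / fact n"
      by (intro divide_left_mono) auto
    then have "real (succession_free_count (Suc n)) / fact (Suc n) * (\<bar>t\<bar> * \<bar>t\<bar> ^ n)
        \<le> real (succession_free_count (Suc n)) / fact n * (\<bar>t\<bar> * \<bar>t\<bar> ^ n)"
      by (rule mult_right_mono) simp
    ultimately show "norm (real (succession_free_count (Suc n)) / fact (Suc n) * t ^ Suc n)
        \<le> \<bar>t\<bar> * norm (2 * egf_deriv_coeff n * t ^ n)"
      by (simp add: abs_mult power_abs mult_ac del: fact_Suc)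
  qed
  then show ?thesis by (subst (asm) summable_Suc_iff)
qed

text \<open>Termwise differentiation gives twice the integrand; the fundamental theorem of calculus
  then recovers the sum from its value 1 at 0.\<close>

lemma succession_free_count_sums:
  fixes t :: real
  assumes "\<bar>t\<bar> < 1 / 2"
  shows "(\<lambda>n. real (succession_free_count n) * t ^ n / fact n) sums
    (1 + 2 * (LBINT z=0..t. exp (- z) / (1 - 2 * z)\<^sup>2))"
proof -
  define c where "c = (\<lambda>n. real (succession_free_count n) / fact n)"
  define f where "f = (\<lambda>z. \<Sum>n. c n * z ^ n)"
  define g where "g = (\<lambda>z::real. exp (- z) / (1 - 2 * z)\<^sup>2)"
  have der: "(f has_real_derivative 2 * g z) (at z)" if "\<bar>z\<bar> < 1 / 2" for z
  proof -
    \<comment> \<open>Termwise differentiation at \<open>z\<close> needs convergence at a point of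
      larger absolute value, again a midpoint.\<close>
    define r where "r = (\<bar>z\<bar> + 1 / 2) / 2"
    have r: "\<bar>r\<bar> < 1 / 2" "norm z < norm r" using that by (auto simp: r_def)
    have "(\<Sum>n. diffs c n * z ^ n) = 2 * g z"
      using sums_mult[OF egf_deriv_sums[OF that], of 2]
      by (simp add: sums_iff mult.assoc c_def diffs_succession_free_count g_def)
    then show ?thesis
      using termdiffs_strong[of c r z] summable_succession_free_count[OF r(1)] r(2)
      by (simp add: f_def c_def)
  qed
  \<comment> \<open>For negative \<open>t\<close> the integral runs backwards, hence
    \<open>min\<close> and \<open>max\<close>.\<close>
  have mem: "\<bar>z\<bar> < 1 / 2" if "min 0 t \<le> z" "z \<le> max 0 t" for z
    using that assms by (auto simp: min_def max_def split: if_splits)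
  have cont: "continuous_on {min 0 t..max 0 t} (\<lambda>z. 2 * g z)"
    unfolding g_def using mem by (intro continuous_intros) force
  have "(LBINT z=0..t. 2 * g z) = f t - f 0"
    using interval_integral_FTC_finite[OF cont, of f] der mem
    by (simp add: has_real_derivative_iff_has_vector_derivative has_vector_derivative_at_within zero_ereal_def)
  moreover have "f 0 = 1"
    unfolding f_def using powser_zero[of c] by (simp add: c_def succession_free_count_0)
  ultimately have "f t = 1 + 2 * (LBINT z=0..t. g z)" by simp
  moreover have "(\<lambda>n. c n * t ^ n) sums f t"
    unfolding f_def c_def by (rule summable_sums[OF summable_succession_free_count[OF assms]])
  ultimately show ?thesis by (simp add: c_def g_def)
qed

section \<open>The initial values\<close>

text \<open>Pascal's rule in a form that lets the simplifier evaluate binomials of numerals.\<close>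

lemma binomial_numeral_numeral:
  "numeral k choose numeral l =
     (pred_numeral k choose pred_numeral l) + (pred_numeral k choose numeral l)"
  by (simp only: numeral_eq_Suc binomial_Suc_Suc)

lemma succession_free_count_values:
  "map succession_free_count [0..<11] =
     [1, 2, 6, 34, 262, 2562, 30278, 419234, 6651846, 118950658, 2366492038]"
proof -
  have "map (\<lambda>n. \<Sum>j\<le>n. (- 1) ^ j * int (n choose j) * 2 ^ (Suc n - j) * fact (Suc n - j)) [0..<10] =
    [2, 6, 34, 262, 2562, 30278, 419234, 6651846, 118950658, 2366492038]"
    by (simp add: upt_rec atMost_nat_numeral fact_numeral binomial_numeral_numeral)
  \<comment> \<open>The alternating sum is evaluated in the integers; injectivity of
    \<open>int\<close> carries the values back.\<close>
  then have "map int (map succession_free_count (map Suc [0..<10])) =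
    map int [2, 6, 34, 262, 2562, 30278, 419234, 6651846, 118950658, 2366492038]"
    by (simp add: o_def succession_free_count_Suc)
  then have "map succession_free_count (map Suc [0..<10]) =
    [2, 6, 34, 262, 2562, 30278, 419234, 6651846, 118950658, 2366492038]"
    by (rule map_injective) simp
  moreover have "[0..<11] = 0 # map Suc [0..<10]"
    by (simp add: map_Suc_upt upt_conv_Cons)
  ultimately show ?thesis by (simp add: succession_free_count_0)
qed

text \<open>The generating function is given both formally and as a convergent real series; 1/2 is
  the singularity of the integrand.\<close>

theorem theorem1:
  shows "Abs_fps (\<lambda>n. real (succession_free_count n) / fact n) =
           1 + 2 * fps_integral0 (fps_exp (- 1) / (1 - 2 * fps_X)\<^sup>2) \<and>
         (\<forall>t::real. \<bar>t\<bar> < 1 / 2 \<longrightarrow>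
           (\<lambda>n. real (succession_free_count n) * t ^ n / fact n) sums
             (1 + 2 * (LBINT z=0..t. exp (- z) / (1 - 2 * z)\<^sup>2))) \<and>
         map succession_free_count [0..<11] =
           [1, 2, 6, 34, 262, 2562, 30278, 419234, 6651846, 118950658, 2366492038]"
  using succession_free_count_fps succession_free_count_sums succession_free_count_values by blast

end
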